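(* Let $(A,\omega)$ be a commutative baric $K$-algebra satisfying $2x^{2}x^{4}=\omega(x)^{2}x^{4}+\omega(x)^{4}x^{2}$ for all $x\in A$, with Peirce decomposition $A=Ke\oplus A_0\oplus A_{\frac12}\oplus A_{\lambda}\oplus A_{\bar\lambda}$ relative to a non-zero idempotent $e$. Then $A$ is a Bernstein algebra if and only if $A_\lambda=A_{\bar\lambda}=0$.
   Context: $K$ is an algebraically closed (infinite, commutative) field of characteristic different from $2$. Algebras are commutative but not necessarily associative. A baric $K$-algebra $(A,\omega)$ is a $K$-algebra $A$ with a non-zero algebra homomorphism $\omega:A\to K$. Principal powers are $x^1=x$, $x^{k+1}=x\,x^{k}$. A baric algebra $(A,\omega)$ is a Bernstein algebra if $(x^2)^2=\omega(x)^2x^2$ for all $x\in A$. Here $\lambda=\frac{-1-i\sqrt{23}}{4}$, $\bar\lambda=\frac{-1+i\sqrt{23}}{4}$, where $i\sqrt{23}$ denotes a fixed square root of $-23$ in $K$, and for an idempotent $e$, $A_\alpha=\{x\in\ker\omega: ex=\alpha x\}$ for $\alpha\in\{0,\frac12,\lambda,\bar\lambda\}$. *)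

theory Defs
  imports Complex_Main "HOL-Computational_Algebra.Polynomial"
begin

text \<open>The algebra is the whole type \<open>'a\<close>; no associativity, unit or finiteness of dimension is
  assumed. Bilinearity is stated on the left only, since commutativity gives the other side.\<close>

locale commutative_algebra = vector_space scale
  for scale :: "'k::field \<Rightarrow> 'a::ab_group_add \<Rightarrow> 'a" (infixr \<open>*s\<close> 75) +
  fixes mul :: "'a \<Rightarrow> 'a \<Rightarrow> 'a" (infixl \<open>\<cdot>\<close> 70)
  assumes mult_add_left: "(x + y) \<cdot> z = x \<cdot> z + y \<cdot> z"
    and mult_scale_left: "(c *s x) \<cdot> y = c *s (x \<cdot> y)"
    and mult_commute: "x \<cdot> y = y \<cdot> x"

locale baric_algebra = commutative_algebra scale mul
  for scale :: "'k::field \<Rightarrow> 'a::ab_group_add \<Rightarrow> 'a" (infixr \<open>*s\<close> 75)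
    and mul :: "'a \<Rightarrow> 'a \<Rightarrow> 'a" (infixl \<open>\<cdot>\<close> 70) +
  fixes \<omega> :: "'a \<Rightarrow> 'k"
  assumes weight_linear: "Vector_Spaces.linear scale (*) \<omega>"
    and weight_mult: "\<omega> (x \<cdot> y) = \<omega> x * \<omega> y"
    and weight_nonzero: "\<exists>x. \<omega> x \<noteq> 0"

locale bernstein_algebra = baric_algebra scale mul \<omega>
  for scale :: "'k::field \<Rightarrow> 'a::ab_group_add \<Rightarrow> 'a" (infixr \<open>*s\<close> 75)
    and mul :: "'a \<Rightarrow> 'a \<Rightarrow> 'a" (infixl \<open>\<cdot>\<close> 70)
    and \<omega> :: "'a \<Rightarrow> 'k" +
  assumes bernstein: "(x \<cdot> x) \<cdot> (x \<cdot> x) = (\<omega> x)\<^sup>2 *s (x \<cdot> x)"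

text \<open>There is no unit, so the value at exponent 0 is a dummy.\<close>

fun principal_power :: "('a::zero \<Rightarrow> 'a \<Rightarrow> 'a) \<Rightarrow> 'a \<Rightarrow> nat \<Rightarrow> 'a" where
  "principal_power mul x 0 = 0"
| "principal_power mul x (Suc 0) = x"
| "principal_power mul x (Suc (Suc k)) = mul x (principal_power mul x (Suc k))"

definition peirce_space ::
  "('k::field \<Rightarrow> 'a::ab_group_add \<Rightarrow> 'a) \<Rightarrow> ('a \<Rightarrow> 'a \<Rightarrow> 'a) \<Rightarrow> ('a \<Rightarrow> 'k) \<Rightarrow> 'a \<Rightarrow> 'k \<Rightarrow> 'a set" where
  "peirce_space scale mul \<omega> e \<alpha> = {x. \<omega> x = 0 \<and> mul e x = scale \<alpha> x}"

text \<open>\<open>A = Ke \<oplus> A\<^sub>0 \<oplus> A\<^bsub>1/2\<^esub> \<oplus> A\<^bsub>\<lambda>\<^esub> \<oplus> A\<^bsub>\<lambda>'\<^esub>\<close> as an internal direct sum: the addition map from the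
  product of the five subspaces to \<open>A\<close> is a bijection.\<close>

definition peirce_decomposition ::
  "('k::field \<Rightarrow> 'a::ab_group_add \<Rightarrow> 'a) \<Rightarrow> ('a \<Rightarrow> 'a \<Rightarrow> 'a) \<Rightarrow> ('a \<Rightarrow> 'k) \<Rightarrow> 'a \<Rightarrow> 'k \<Rightarrow> 'k \<Rightarrow> bool" where
  "peirce_decomposition scale mul \<omega> e lam lam' \<longleftrightarrow>
     bij_betw (\<lambda>(a, x, y, z, w). a + x + y + z + w)
       (range (\<lambda>c. scale c e) \<times>
        peirce_space scale mul \<omega> e 0 \<times> peirce_space scale mul \<omega> e (1/2) \<times>
        peirce_space scale mul \<omega> e lam \<times> peirce_space scale mul \<omega> e lam')
       UNIV"

end

theory Submission
  imports Defs
begin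

text \<open>
  Over an infinite field an identity in \<open>A\<close> may be expanded along a line \<open>e + t n\<close> with
  \<open>\<omega> n = 0\<close>: each coefficient of the resulting polynomial in \<open>t\<close> vanishes
  (\<open>vanishing_polynomial_coeffs\<close>).

  If \<open>A\<close> is Bernstein and \<open>e y = \<alpha> y\<close>, the linear coefficient of \<open>(x\<^sup>2)\<^sup>2 - x\<^sup>2\<close> along \<open>e + t y\<close> is
  \<open>(4 \<alpha>\<^sup>2 - 2 \<alpha>) y\<close>, so \<open>\<alpha>\<close> is \<open>0\<close> or \<open>1/2\<close> unless \<open>y = 0\<close> (\<open>peirce_eigenvalue\<close>). A non-zero vector of
  \<open>A\<^sub>\<lambda>\<close> would then also lie in \<open>A\<^sub>0\<close> or \<open>A\<^bsub>1/2\<^esub>\<close>, against directness of the Peirce sum. Arguing by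
  directness avoids asking in which characteristics \<open>\<lambda>\<close> equals \<open>0\<close> or \<open>1/2\<close>.

  Conversely, if the two exceptional spaces vanish, then \<open>ker \<omega> = U \<oplus> V\<close> with \<open>U = A\<^bsub>1/2\<^esub>\<close> and
  \<open>V = A\<^sub>0\<close>. The coefficients of \<open>t\<^sup>2\<close>, \<open>t\<^sup>3\<close>, \<open>t\<^sup>4\<close> of the given identity along \<open>e + t (u + v)\<close>
  (\<open>power_identities\<close>) are split into their components in \<open>U\<close> and \<open>V\<close>, and further by the parity in \<open>u\<close>.
  Degree two gives \<open>U\<^sup>2 \<subseteq> V\<close>, \<open>V\<^sup>2 \<subseteq> U\<close> and \<open>U V \<subseteq> U\<close>; degree three gives
  \<open>u\<^sup>3 = u (u v) = u v\<^sup>2 = 0\<close>; degree four, together with linearizations of the cubic relations, gives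
  \<open>(u\<^sup>2)\<^sup>2 = u\<^sup>2 (u v) = (u v)\<^sup>2 = 0\<close>. Every product that could violate the Bernstein
  identity of \<open>\<alpha> e + u + v\<close> is among these or follows from the cubic relations (\<open>square_of_square\<close>).

  Characteristic \<open>3\<close> needs a separate remark, because degree two yields \<open>U V \<subseteq> U\<close> only up to a factor
  \<open>3\<close>. There \<open>s\<^sup>2 = -23 = 1\<close>, so one of \<open>\<lambda>\<close>, \<open>\<lambda>'\<close> is \<open>0\<close>; hence \<open>V = A\<^sub>0\<close> is one of the spaces
  assumed to vanish.
\<close>

section \<open>Linear algebra over an infinite field\<close>

text \<open>Over a finite field the polynomial \<open>1 + \<Prod> (X - a)\<close> takes the value \<open>1\<close> everywhere, hence has no
  root.\<close>

lemma infinite_UNIV_alg_closed_field: "infinite (UNIV :: 'k::alg_closed_field set)"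
proof
  assume fin: "finite (UNIV :: 'k set)"
  define p :: "'k poly" where "p = (\<Prod>a\<in>UNIV. [:- a, 1:]) + 1"
  have one: "poly p x = 1" for x
    using fin by (simp add: p_def poly_prod prod_zero_iff)
  have "degree (\<Prod>a\<in>(UNIV::'k set). [:- a, 1:]) = card (UNIV :: 'k set)"
    by (subst degree_prod_eq_sum_degree) auto
  moreover have "card (UNIV :: 'k set) > 0"
    using fin by (simp add: finite_UNIV_card_ge_0)
  ultimately have "degree p > 0"
    unfolding p_def by (subst degree_add_eq_left) auto
  then obtain x where "poly p x = 0"
    using alg_closed_imp_poly_has_root by blast
  with one[of x] show False by simp
qed

context commutative_algebra
begin

text \<open>Coordinates with respect to a basis turn linear consequences between vector equations into ring
  identities in the field, where the Groebner basis method \<open>algebra\<close> decides them.\<close>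

definition coord :: "'a \<Rightarrow> 'a \<Rightarrow> 'k" where
  "coord b v = representation (extend_basis {}) v b"

lemma coord_simps [simp]:
  "coord b 0 = 0"
  "coord b (v + w) = coord b v + coord b w"
  "coord b (v - w) = coord b v - coord b w"
  "coord b (- v) = - coord b v"
  "coord b (c *s v) = c * coord b v"
  by (simp_all add: coord_def representation_zero representation_add representation_diff
      representation_neg representation_scale independent_extend_basis span_extend_basis
      independent_empty)

lemma coord_eqI:
  assumes "\<And>b. coord b v = coord b w"
  shows "v = w"
proof -
  let ?B = "extend_basis {}"
  have rep: "(\<Sum>b | representation ?B x b \<noteq> 0. representation ?B x b *s b) = x" for x
    by (rule sum_nonzero_representation_eq)
      (simp_all add: independent_extend_basis independent_empty span_extend_basis)
  have "representation ?B v = representation ?B w"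
    using assms unfolding coord_def by blast
  from arg_cong[OF this, of "\<lambda>g. \<Sum>b | g b \<noteq> 0. g b *s b"] show ?thesis
    by (simp only: rep)
qed

text \<open>The list \<open>cs\<close> holds the coefficients of a vector-valued polynomial in \<open>t\<close>, lowest degree first,
  and the fold is its Horner evaluation. Each coordinate is an ordinary polynomial with infinitely
  many roots.\<close>

lemma vanishing_polynomial_coeffs:
  assumes inf: "infinite (UNIV :: 'k set)"
    and zero: "\<And>t. foldr (\<lambda>c acc. c + t *s acc) cs 0 = 0"
  shows "\<forall>c\<in>set cs. c = 0"
proof (intro ballI coord_eqI)
  fix c b assume c: "c \<in> set cs"
  have eval: "poly (Poly (map (coord b) cs)) t = coord b (foldr (\<lambda>c acc. c + t *s acc) cs 0)" for t
    by (induction cs) simp_all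
  have "Poly (map (coord b) cs) = 0"
    using inf poly_roots_finite[of "Poly (map (coord b) cs)"] by (auto simp: eval zero)
  then obtain n where "map (coord b) cs = replicate n 0"
    by (auto simp: Poly_eq_0)
  then have "coord b c \<in> set (replicate n 0)"
    using c by (metis imageI set_map)
  then show "coord b c = coord b 0" by simp
qed

lemma mul_add_right: "z \<cdot> (x + y) = z \<cdot> x + z \<cdot> y"
  by (metis mult_add_left mult_commute)

lemma mul_scale_right: "y \<cdot> (c *s x) = c *s (y \<cdot> x)"
  by (metis mult_scale_left mult_commute)

lemma mul_zero_left [simp]: "0 \<cdot> x = 0"
  using mult_add_left[of 0 0 x] by simp

lemma mul_zero_right [simp]: "x \<cdot> 0 = 0"
  using mult_commute[of x 0] by simp

lemma mul_minus_left [simp]: "(- x) \<cdot> y = - (x \<cdot> y)"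
  using mult_scale_left[of "-1" x y] by simp

lemma mul_minus_right [simp]: "x \<cdot> (- y) = - (x \<cdot> y)"
  by (metis mul_minus_left mult_commute)

lemma mul_diff_left: "(x - y) \<cdot> z = x \<cdot> z - y \<cdot> z"
  using mult_add_left[of x "- y" z] by simp

lemma mul_diff_right: "z \<cdot> (x - y) = z \<cdot> x - z \<cdot> y"
  using mul_add_right[of z x "- y"] by simp

lemmas mul_expand = mult_add_left mul_add_right mul_diff_left mul_diff_right mult_scale_left mul_scale_right
  scale_right_distrib scale_right_diff_distrib

end

context baric_algebra
begin

lemma weight_simps [simp]:
  "\<omega> 0 = 0" "\<omega> (x + y) = \<omega> x + \<omega> y" "\<omega> (x - y) = \<omega> x - \<omega> y" "\<omega> (c *s x) = c * \<omega> x"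
proof -
  interpret w: Vector_Spaces.linear scale "(*)" \<omega> by (rule weight_linear)
  show "\<omega> 0 = 0" "\<omega> (x + y) = \<omega> x + \<omega> y" "\<omega> (x - y) = \<omega> x - \<omega> y" "\<omega> (c *s x) = c * \<omega> x"
    by (simp_all add: w.zero w.add w.diff w.scale)
qed

end

section \<open>Peirce eigenvalues of a Bernstein algebra\<close>

text \<open>In the expansion of \<open>(x\<^sup>2)\<^sup>2 - x\<^sup>2\<close> at \<open>x = e + t y\<close> only the linear coefficient matters; the
  others are named because the polynomial has to be written out in full before its coefficients can
  be compared.\<close>

lemma (in bernstein_algebra) peirce_eigenvalue:
  assumes inf: "infinite (UNIV :: 'k set)" and two: "(2::'k) \<noteq> 0"
    and e: "e \<cdot> e = e" "\<omega> e = 1"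
    and y: "\<omega> y = 0" "e \<cdot> y = \<alpha> *s y"
  shows "\<alpha> = 0 \<or> \<alpha> = 1/2 \<or> y = 0"
proof -
  have ye: "y \<cdot> e = \<alpha> *s y"
    using y(2) by (simp add: mult_commute)
  define a where "a = y \<cdot> y"
  define c1 where "c1 = (4 * \<alpha>\<^sup>2 - 2 * \<alpha>) *s y"
  define c2 where "c2 = (4 * \<alpha>\<^sup>2) *s a + 2 *s (e \<cdot> a) - a"
  define c3 where "c3 = (4 * \<alpha>) *s (y \<cdot> a)"
  define c4 where "c4 = a \<cdot> a"
  have "foldr (\<lambda>c acc. c + t *s acc) [0, c1, c2, c3, c4] 0 = 0" for t
  proof -
    let ?x = "e + t *s y"
    have sq: "?x \<cdot> ?x = e + (2 * \<alpha> * t) *s y + t\<^sup>2 *s a"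
      by (rule coord_eqI) (simp add: mul_expand e y ye a_def algebra_simps power2_eq_square)
    have wt: "\<omega> ?x = 1" by (simp add: e y)
    have "(?x \<cdot> ?x) \<cdot> (?x \<cdot> ?x) - ?x \<cdot> ?x = 0"
      using bernstein[of ?x] unfolding wt by simp
    moreover have "foldr (\<lambda>c acc. c + t *s acc) [0, c1, c2, c3, c4] 0
        = (?x \<cdot> ?x) \<cdot> (?x \<cdot> ?x) - ?x \<cdot> ?x"
      unfolding sq
      by (rule coord_eqI)
        (simp add: mul_expand e y ye c1_def c2_def c3_def c4_def mult_commute[of a e] mult_commute[of a y]
          algebra_simps power2_eq_square flip: a_def)
    ultimately show ?thesis by simp
  qed
  then have "c1 = 0"
    using vanishing_polynomial_coeffs[OF inf, of "[0, c1, c2, c3, c4]"] by simp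
  then have "2 * \<alpha> * (2 * \<alpha> - 1) = 0 \<or> y = 0"
    by (simp add: c1_def algebra_simps power2_eq_square)
  moreover have "\<alpha> = 1/2" if "2 * \<alpha> - 1 = 0"
    using that two by (simp add: eq_divide_eq mult.commute)
  ultimately show ?thesis
    using two by auto
qed

section \<open>The quartic identity when the operator of the idempotent has eigenvalues 0 and 1/2\<close>

text \<open>The assumption \<open>half_or_zero\<close> is the form \<open>2 L\<^sup>2 = L\<close> of the statement that \<open>L\<close>, multiplication by
  \<open>e\<close>, acts on \<open>ker \<omega>\<close> diagonalizably with eigenvalues \<open>0\<close> and \<open>1/2\<close>. The last assumption says that
  in characteristic \<open>3\<close> the eigenvalue \<open>0\<close> does not occur.\<close>

locale quartic_baric_algebra = baric_algebra scale mul \<omega>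
  for scale :: "'k::field \<Rightarrow> 'a::ab_group_add \<Rightarrow> 'a" (infixr \<open>*s\<close> 75)
    and mul :: "'a \<Rightarrow> 'a \<Rightarrow> 'a" (infixl \<open>\<cdot>\<close> 70)
    and \<omega> :: "'a \<Rightarrow> 'k" +
  fixes e :: 'a
  assumes infinite_scalars: "infinite (UNIV :: 'k set)"
    and two_nonzero: "(2::'k) \<noteq> 0"
    and quartic: "2 *s ((x \<cdot> x) \<cdot> (x \<cdot> (x \<cdot> (x \<cdot> x))))
                  = (\<omega> x)\<^sup>2 *s (x \<cdot> (x \<cdot> (x \<cdot> x))) + (\<omega> x)^4 *s (x \<cdot> x)"
    and idem: "e \<cdot> e = e" and weight_idem: "\<omega> e = 1"
    and half_or_zero: "\<omega> y = 0 \<Longrightarrow> 2 *s (e \<cdot> (e \<cdot> y)) = e \<cdot> y"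
    and three_nonzero_or_trivial: "(3::'k) \<noteq> 0 \<or> (\<forall>v. e \<cdot> v = 0 \<longrightarrow> v = 0)"
begin

text \<open>The Peirce spaces \<open>A\<^bsub>1/2\<^esub>\<close> and \<open>A\<^sub>0\<close>. They lie in \<open>ker \<omega>\<close> because \<open>\<omega> e = 1\<close> forces weight
  zero on both (\<open>weight_U\<close>, \<open>weight_V\<close>).\<close>

definition U :: "'a set" where "U = {x. 2 *s (e \<cdot> x) = x}"
definition V :: "'a set" where "V = {x. e \<cdot> x = 0}"

text \<open>One half is kept as an opaque constant with \<open>2 h = 1\<close>: fractions are then polynomial expressions,
  within reach of \<open>algebra\<close> in every characteristic other than \<open>2\<close>.\<close>

definition h :: 'k where "h = 1 / 2"

lemma two_h: "2 * h = 1"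
  using two_nonzero by (simp add: h_def)

lemma U_iff: "x \<in> U \<longleftrightarrow> e \<cdot> x = h *s x"
proof
  assume "x \<in> U"
  then have "h *s x = h *s (2 *s (e \<cdot> x))" by (simp add: U_def)
  then show "e \<cdot> x = h *s x" using two_h by (simp add: mult.commute)
next
  assume "e \<cdot> x = h *s x"
  then show "x \<in> U" using two_h by (simp add: U_def)
qed

lemma V_iff: "x \<in> V \<longleftrightarrow> e \<cdot> x = 0"
  by (simp add: V_def)

lemma weight_V: "v \<in> V \<Longrightarrow> \<omega> v = 0"
  using weight_mult[of e v] by (simp add: V_iff weight_idem)

lemma weight_U:
  assumes "u \<in> U" shows "\<omega> u = 0"
proof -
  have "\<omega> u = h * \<omega> u"
    using weight_mult[of e u] assms by (simp add: U_iff weight_idem)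
  then have "2 * \<omega> u = \<omega> u" using two_h by algebra
  then show ?thesis by (metis add_cancel_left_left mult_2)
qed

lemma uminus_U: "u \<in> U \<Longrightarrow> - u \<in> U"
  and zero_V: "0 \<in> V"
  by (simp_all add: U_iff V_iff)

text \<open>With \<open>x = e + t n\<close> the powers are \<open>x\<^sup>2 = e + t u + t\<^sup>2 a\<close>, \<open>x\<^sup>3 = e + t u + t\<^sup>2 w + t\<^sup>3 (n a)\<close> and
  \<open>x\<^sup>4 = e + t u + t\<^sup>2 p + t\<^sup>3 q + t\<^sup>4 r\<close>; the linear coefficient stays at \<open>u = 2 e n\<close>, the
  \<open>1/2\<close>-component of \<open>n\<close>, since \<open>2 e u = u\<close>. The three conclusions are the coefficients of
  \<open>t\<^sup>2\<close>, \<open>t\<^sup>3\<close>, \<open>t\<^sup>4\<close> in \<open>2 x\<^sup>2 x\<^sup>4 = x\<^sup>4 + x\<^sup>2\<close>.\<close>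

lemma power_identities:
  assumes n: "\<omega> n = 0"
    and u: "u = 2 *s (e \<cdot> n)" and a: "a = n \<cdot> n"
    and w: "w = e \<cdot> a + n \<cdot> u" and p: "p = e \<cdot> w + n \<cdot> u"
    and q: "q = e \<cdot> (n \<cdot> a) + n \<cdot> w" and r: "r = n \<cdot> (n \<cdot> a)"
  shows "2 *s (e \<cdot> p + u \<cdot> u + e \<cdot> a) = p + a"
    and "2 *s (e \<cdot> q + u \<cdot> p + u \<cdot> a) = q"
    and "2 *s (e \<cdot> r + u \<cdot> q + a \<cdot> p) = r"
proof -
  define c2 where "c2 = 2 *s (e \<cdot> p + u \<cdot> u + e \<cdot> a) - (p + a)"
  define c3 where "c3 = 2 *s (e \<cdot> q + u \<cdot> p + u \<cdot> a) - q"
  define c4 where "c4 = 2 *s (e \<cdot> r + u \<cdot> q + a \<cdot> p) - r"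
  define c5 where "c5 = 2 *s (u \<cdot> r + a \<cdot> q)"
  define c6 where "c6 = 2 *s (a \<cdot> r)"
  \<comment> \<open>Writing \<open>u\<close> as \<open>2 g\<close> with \<open>g = e n\<close> keeps the expansions free of fractions; \<open>u\<close> is replaced by \<open>2 g\<close>
      only after all products with \<open>e\<close> have been evaluated.\<close>
  obtain g where g: "e \<cdot> n = g" by blast
  have u2: "u = 2 *s g" by (simp add: u g)
  have en: "n \<cdot> e = g" by (simp add: g mult_commute[of n])
  have eu: "e \<cdot> u = g" "u \<cdot> e = g"
    using half_or_zero[OF n] by (simp_all add: u mul_scale_right g mult_commute[of _ e])
  have "foldr (\<lambda>c acc. c + t *s acc) [0, 0, c2, c3, c4, c5, c6] 0 = 0" for t
  proof -
    let ?x = "e + t *s n"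
    have wt: "\<omega> ?x = 1" by (simp add: weight_idem n)
    have x2: "?x \<cdot> ?x = e + t *s u + t\<^sup>2 *s a"
      by (rule coord_eqI) (simp add: mul_expand idem en g u2 a, algebra)
    have x3: "?x \<cdot> (e + t *s u + t\<^sup>2 *s a) = e + t *s u + t\<^sup>2 *s w + t^3 *s (n \<cdot> a)"
      by (rule coord_eqI) (simp add: mul_expand idem en g eu w, simp add: u2, algebra)
    have x4: "?x \<cdot> (e + t *s u + t\<^sup>2 *s w + t^3 *s (n \<cdot> a))
        = e + t *s u + t\<^sup>2 *s p + t^3 *s q + t^4 *s r"
      by (rule coord_eqI) (simp add: mul_expand idem en g eu p q r, simp add: u2, algebra)
    have "2 *s ((e + t *s u + t\<^sup>2 *s a) \<cdot> (e + t *s u + t\<^sup>2 *s p + t^3 *s q + t^4 *s r))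
        = (e + t *s u + t\<^sup>2 *s p + t^3 *s q + t^4 *s r) + (e + t *s u + t\<^sup>2 *s a)"
      using quartic[of ?x] unfolding x2 x3 x4 wt by simp
    moreover have "foldr (\<lambda>c acc. c + t *s acc) [0, 0, c2, c3, c4, c5, c6] 0
        = 2 *s ((e + t *s u + t\<^sup>2 *s a) \<cdot> (e + t *s u + t\<^sup>2 *s p + t^3 *s q + t^4 *s r))
          - ((e + t *s u + t\<^sup>2 *s p + t^3 *s q + t^4 *s r) + (e + t *s u + t\<^sup>2 *s a))"
      by (rule coord_eqI) (simp add: mul_expand idem eu c2_def c3_def c4_def c5_def c6_def
          mult_commute[of a e] mult_commute[of a u], simp add: u2, algebra)
    ultimately show ?thesis by simp
  qed
  then have "c2 = 0 \<and> c3 = 0 \<and> c4 = 0"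
    using vanishing_polynomial_coeffs[OF infinite_scalars, of "[0, 0, c2, c3, c4, c5, c6]"] by simp
  then show "2 *s (e \<cdot> p + u \<cdot> u + e \<cdot> a) = p + a"
    and "2 *s (e \<cdot> q + u \<cdot> p + u \<cdot> a) = q"
    and "2 *s (e \<cdot> r + u \<cdot> q + a \<cdot> p) = r"
    by (simp_all add: c2_def c3_def c4_def)
qed

lemma U_plus_V:
  assumes "u \<in> U" "v \<in> V"
  shows "\<omega> (u + v) = 0" and "u = 2 *s (e \<cdot> (u + v))"
  using assms by (simp_all add: weight_U weight_V U_def V_def mul_add_right)

lemma zero_of_scaled: "2 *s x = 0 \<Longrightarrow> x = 0" "4 *s x = 0 \<Longrightarrow> x = 0"
proof -
  have "(4::'k) = 2 * 2" by simp
  then have "(4::'k) \<noteq> 0" using two_nonzero by (metis mult_eq_0_iff)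
  then show "2 *s x = 0 \<Longrightarrow> x = 0" "4 *s x = 0 \<Longrightarrow> x = 0"
    using two_nonzero by simp_all
qed

lemma half_on_image: "\<omega> x = 0 \<Longrightarrow> e \<cdot> (e \<cdot> x) = h *s (e \<cdot> x)"
  using half_or_zero U_iff by (simp add: U_def)

text \<open>Every product of elements of weight zero again has weight zero, so on them \<open>2 L\<^sup>2 = L\<close> reduces all
  higher powers of \<open>L\<close> in the coefficient of \<open>t\<^sup>2\<close> to \<open>L\<close> itself.\<close>

lemma degree_two:
  assumes n: "\<omega> n = 0" and u: "u = 2 *s (e \<cdot> n)"
  shows "2 *s (e \<cdot> (n \<cdot> n)) + 2 *s (e \<cdot> (n \<cdot> u)) + 2 *s (u \<cdot> u) = n \<cdot> u + n \<cdot> n"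
proof (rule coord_eqI)
  fix b
  have "\<omega> (n \<cdot> n) = 0" "\<omega> (n \<cdot> u) = 0" by (simp_all add: weight_mult n)
  note half = this[THEN half_on_image]
  show "coord b (2 *s (e \<cdot> (n \<cdot> n)) + 2 *s (e \<cdot> (n \<cdot> u)) + 2 *s (u \<cdot> u)) = coord b (n \<cdot> u + n \<cdot> n)"
    using arg_cong[OF power_identities(1)[OF assms refl refl refl refl refl], of "coord b"] two_h
    by (simp add: mul_expand half) algebra
qed

text \<open>Degree two at \<open>n = u\<close> reads \<open>4 e u\<^sup>2 = 0\<close>, and at \<open>n = v\<close> it reads \<open>2 e v\<^sup>2 = v\<^sup>2\<close>. Products of two
  different elements follow by polarization.\<close>

lemma U_times_U: assumes "u \<in> U" "u' \<in> U" shows "u \<cdot> u' \<in> V"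
proof -
  have square: "x \<cdot> x \<in> V" if "x \<in> U" for x
  proof -
    have "e \<cdot> (x \<cdot> x) = 0"
    proof (rule zero_of_scaled(2), rule coord_eqI)
      fix b
      have "2 *s (e \<cdot> (x \<cdot> x)) + 2 *s (e \<cdot> (x \<cdot> x)) + 2 *s (x \<cdot> x) = x \<cdot> x + x \<cdot> x"
        using degree_two[of x x] that weight_U[OF that] by (simp add: U_def)
      from arg_cong[OF this, of "coord b"]
      show "coord b (4 *s (e \<cdot> (x \<cdot> x))) = coord b 0"
        by simp
    qed
    then show ?thesis by (simp add: V_iff)
  qed
  have "e \<cdot> (u \<cdot> u') = 0"
  proof (rule zero_of_scaled(1), rule coord_eqI)
    fix b
    have "u + u' \<in> U" using assms by (simp add: U_iff mul_expand)
    then have "e \<cdot> (u \<cdot> u') + e \<cdot> (u \<cdot> u') = 0"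
      using square[of "u + u'"] square[of u] square[of u'] assms
      by (simp add: V_iff mul_expand mult_commute[of u' u])
    from arg_cong[OF this, of "coord b"]
    show "coord b (2 *s (e \<cdot> (u \<cdot> u'))) = coord b 0"
      by simp
  qed
  then show ?thesis by (simp add: V_iff)
qed

lemma V_times_V: assumes "v \<in> V" "v' \<in> V" shows "v \<cdot> v' \<in> U"
proof -
  have square: "2 *s (e \<cdot> (x \<cdot> x)) = x \<cdot> x" if "x \<in> V" for x
    using degree_two[of x 0] that weight_V[OF that] by (simp add: V_def)
  have "2 *s (e \<cdot> (v \<cdot> v')) - v \<cdot> v' = 0"
  proof (rule zero_of_scaled(1), rule coord_eqI)
    fix b
    have "v + v' \<in> V" using assms by (simp add: V_iff mul_expand)
    then show "coord b (2 *s (2 *s (e \<cdot> (v \<cdot> v')) - v \<cdot> v')) = coord b 0"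
      using arg_cong[OF square[of "v + v'"], of "coord b"] arg_cong[OF square[of v], of "coord b"]
        arg_cong[OF square[of v'], of "coord b"] assms
      by (simp add: mul_expand mult_commute[of v' v])
  qed
  then show ?thesis by (simp add: U_def)
qed

lemma three_cancel: "v \<in> V \<Longrightarrow> 3 *s x = 0 \<Longrightarrow> v = 0 \<or> x = 0"
  using three_nonzero_or_trivial by (auto simp: V_def)

text \<open>Subtracting the two cases above from degree two at \<open>n = u + v\<close> leaves \<open>6 e (u v) = 3 u v\<close>, which
  is empty in characteristic \<open>3\<close>; there \<open>v = 0\<close> instead.\<close>

lemma U_times_V: assumes u: "u \<in> U" and v: "v \<in> V" shows "u \<cdot> v \<in> U"
proof -
  have "3 *s (2 *s (e \<cdot> (u \<cdot> v)) - u \<cdot> v) = 0"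
  proof (rule coord_eqI)
    fix b
    have fs: "e \<cdot> (u \<cdot> u) = 0" "e \<cdot> (v \<cdot> v) = h *s (v \<cdot> v)"
      using U_times_U[OF u u] V_times_V[OF v v] by (simp_all add: U_iff V_iff)
    show "coord b (3 *s (2 *s (e \<cdot> (u \<cdot> v)) - u \<cdot> v)) = coord b 0"
      using arg_cong[OF degree_two[OF U_plus_V[OF u v]], of "coord b"] two_h
      by (simp add: mul_expand fs mult_commute[of v u])
  qed
  from three_cancel[OF v this] show ?thesis by (auto simp: U_def)
qed

lemma V_times_U: "v \<in> V \<Longrightarrow> u \<in> U \<Longrightarrow> v \<cdot> u \<in> U"
  using U_times_V mult_commute by metis

text \<open>The product rules make the quadratic coefficients \<open>a\<close>, \<open>w\<close>, \<open>p\<close> of \<open>x\<^sup>2\<close>, \<open>x\<^sup>3\<close>, \<open>x\<^sup>4\<close> at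
  \<open>n = u + v\<close> explicit; they differ only in the factor \<open>1\<close>, \<open>1/2\<close>, \<open>1/4\<close> at \<open>v\<^sup>2\<close>. The
  orientation of the equations fits the hypotheses of \<open>power_identities\<close>.\<close>

lemma quadratic_coefficients:
  assumes u: "u \<in> U" and v: "v \<in> V"
  shows "u \<cdot> u + v \<cdot> v + 2 *s (u \<cdot> v) = (u + v) \<cdot> (u + v)"
    and "u \<cdot> u + h *s (v \<cdot> v) + 2 *s (u \<cdot> v)
      = e \<cdot> (u \<cdot> u + v \<cdot> v + 2 *s (u \<cdot> v)) + (u + v) \<cdot> u"
    and "u \<cdot> u + (h * h) *s (v \<cdot> v) + 2 *s (u \<cdot> v)
      = e \<cdot> (u \<cdot> u + h *s (v \<cdot> v) + 2 *s (u \<cdot> v)) + (u + v) \<cdot> u"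
proof -
  have pe: "e \<cdot> (u \<cdot> u) = 0" "e \<cdot> (v \<cdot> v) = h *s (v \<cdot> v)" "e \<cdot> (u \<cdot> v) = h *s (u \<cdot> v)"
    using U_times_U[OF u u] V_times_V[OF v v] U_times_V[OF u v] by (simp_all add: U_iff V_iff)
  note expand = mul_expand pe mult_commute[of v u]
  show "u \<cdot> u + v \<cdot> v + 2 *s (u \<cdot> v) = (u + v) \<cdot> (u + v)"
    by (rule coord_eqI) (simp add: expand)
  show "u \<cdot> u + h *s (v \<cdot> v) + 2 *s (u \<cdot> v)
      = e \<cdot> (u \<cdot> u + v \<cdot> v + 2 *s (u \<cdot> v)) + (u + v) \<cdot> u"
    by (rule coord_eqI, simp add: expand) (use two_h in algebra)
  show "u \<cdot> u + (h * h) *s (v \<cdot> v) + 2 *s (u \<cdot> v)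
      = e \<cdot> (u \<cdot> u + h *s (v \<cdot> v) + 2 *s (u \<cdot> v)) + (u + v) \<cdot> u"
    by (rule coord_eqI, simp add: expand) (use two_h in algebra)
qed

text \<open>The operator \<open>2 L - 1\<close> kills \<open>U\<close> and is \<open>-1\<close> on \<open>V\<close>, so the coefficient of \<open>t\<^sup>3\<close> expresses the
  \<open>V\<close>-component of \<open>q\<close> by \<open>2 u (p + a)\<close>; computing that component directly as well leaves the relation
  below.\<close>

lemma degree_three:
  assumes u: "u \<in> U" and v: "v \<in> V"
  shows "4 *s (u \<cdot> (u \<cdot> u)) + 6 *s (u \<cdot> (u \<cdot> v)) + 2 *s (u \<cdot> (v \<cdot> v)) = 0"
proof -
  obtain A B C where abc: "u \<cdot> u = A" "v \<cdot> v = B" "u \<cdot> v = C" by blast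
  have mem: "A \<in> V" "B \<in> U" "C \<in> U" using U_times_U[OF u u] V_times_V[OF v v] U_times_V[OF u v]
    by (simp_all add: abc)
  have vu: "v \<cdot> u = C" using abc mult_commute by metis
  note pe = mem(1)[unfolded V_iff] mem(2,3)[unfolded U_iff]
  have pe3: "e \<cdot> (u \<cdot> A) = h *s (u \<cdot> A)" "e \<cdot> (v \<cdot> A) = h *s (v \<cdot> A)"
    "e \<cdot> (v \<cdot> B) = h *s (v \<cdot> B)" "e \<cdot> (v \<cdot> C) = h *s (v \<cdot> C)"
    using U_times_V[OF u mem(1)] V_times_V[OF v mem(1)] V_times_U[OF v mem(2)] V_times_U[OF v mem(3)]
    by (simp_all add: U_iff)
  have pe3': "e \<cdot> (u \<cdot> B) = 0" "e \<cdot> (u \<cdot> C) = 0"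
    using U_times_U[OF u mem(2)] U_times_U[OF u mem(3)] by (simp_all add: V_iff)
  note a = quadratic_coefficients(1)[OF u v, unfolded abc]
    and w = quadratic_coefficients(2)[OF u v, unfolded abc]
    and p = quadratic_coefficients(3)[OF u v, unfolded abc]
  show ?thesis
  proof (rule coord_eqI)
    fix b
    show "coord b (4 *s (u \<cdot> (u \<cdot> u)) + 6 *s (u \<cdot> (u \<cdot> v)) + 2 *s (u \<cdot> (v \<cdot> v))) = coord b 0"
      using arg_cong[OF power_identities(2)[OF U_plus_V[OF u v] a w p refl refl], of "coord b"] two_h
      by (simp add: abc mul_expand pe pe3 pe3') algebra
  qed
qed

text \<open>The three terms of \<open>degree_three\<close> have degrees \<open>3\<close>, \<open>2\<close>, \<open>1\<close> in \<open>u\<close>: \<open>v = 0\<close> isolates the first,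
  and adding the relation for \<open>- u\<close> isolates the second, with coefficient \<open>12\<close>.\<close>

lemma U_cube_zero: assumes "u \<in> U" shows "u \<cdot> (u \<cdot> u) = 0"
  by (rule zero_of_scaled(2)) (use degree_three[OF assms zero_V] in simp)

lemma u_uv_zero: assumes u: "u \<in> U" and v: "v \<in> V" shows "u \<cdot> (u \<cdot> v) = 0"
proof -
  have "3 *s (4 *s (u \<cdot> (u \<cdot> v))) = 0"
  proof (rule coord_eqI)
    fix b
    show "coord b (3 *s (4 *s (u \<cdot> (u \<cdot> v)))) = coord b 0"
      using arg_cong[OF degree_three[OF u v], of "coord b"]
        arg_cong[OF degree_three[OF uminus_U[OF u] v], of "coord b"]
      by simp algebra
  qed
  from three_cancel[OF v this] show ?thesis
    using zero_of_scaled(2)[of "u \<cdot> (u \<cdot> v)"] by (elim disjE) simp_all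
qed

lemma u_vv_zero: assumes u: "u \<in> U" and v: "v \<in> V" shows "u \<cdot> (v \<cdot> v) = 0"
  by (rule zero_of_scaled(1)) (use degree_three[OF u v] U_cube_zero[OF u] u_uv_zero[OF u v] in simp)

lemma u_uv_zero_linearized:
  assumes "u \<in> U" "u' \<in> U" "v \<in> V"
  shows "u \<cdot> (u' \<cdot> v) + u' \<cdot> (u \<cdot> v) = 0"
proof -
  have "u + u' \<in> U" using assms by (simp add: U_iff mul_expand)
  from u_uv_zero[OF this assms(3)] show ?thesis
    using assms by (simp add: mul_expand u_uv_zero add.commute)
qed

text \<open>This follows from the cubic relations alone: the part of \<open>(u + u')\<^sup>3 = 0\<close> that is linear in \<open>u'\<close> is
  \<open>u\<^sup>2 u' + 2 u (u u') = 0\<close>, and for \<open>u' = v\<^sup>2\<close> its second term vanishes by \<open>u v\<^sup>2 = 0\<close>. Degree four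
  would give the relation only with a factor \<open>5\<close>, which is useless in characteristic \<open>5\<close>.\<close>

lemma uu_vv_zero: assumes u: "u \<in> U" and v: "v \<in> V" shows "(u \<cdot> u) \<cdot> (v \<cdot> v) = 0"
proof -
  let ?B = "v \<cdot> v"
  have B: "?B \<in> U" using V_times_V[OF v v] .
  have "u + ?B \<in> U" using u B by (simp add: U_iff mul_expand)
  note cube = U_cube_zero[OF this]
  have uB: "u \<cdot> ?B = 0" "?B \<cdot> u = 0" using u_vv_zero[OF u v] by (simp_all add: mult_commute)
  have "?B \<cdot> (u \<cdot> u) = 0"
    using cube U_cube_zero[OF u] U_cube_zero[OF B] u_vv_zero[OF B v] uB by (simp add: mul_expand)
  then show ?thesis by (simp add: mult_commute)
qed

text \<open>The \<open>U\<close>- and the \<open>V\<close>-component of the coefficient of \<open>t\<^sup>4\<close>, after discarding what the cubic relations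
  already kill. Taking \<open>u' = v\<^sup>2\<close> and \<open>u' = u v\<close> in the linearized relation \<open>u (u' v) + u' (u v) = 0\<close>
  gives \<open>u (v v\<^sup>2) = 0\<close> and \<open>u (v (u v)) = - (u v)\<^sup>2\<close>.\<close>

lemma degree_four:
  assumes u: "u \<in> U" and v: "v \<in> V"
  shows "(u \<cdot> u) \<cdot> (u \<cdot> u) + 4 *s ((u \<cdot> u) \<cdot> (u \<cdot> v)) = 0"
    and "u \<cdot> (v \<cdot> (u \<cdot> u)) + 2 *s ((u \<cdot> v) \<cdot> (u \<cdot> v)) = 0"
proof -
  obtain A B C where abc: "u \<cdot> u = A" "v \<cdot> v = B" "u \<cdot> v = C" by blast
  have mem: "A \<in> V" "B \<in> U" "C \<in> U" using U_times_U[OF u u] V_times_V[OF v v] U_times_V[OF u v]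
    by (simp_all add: abc)
  have vu: "v \<cdot> u = C" using abc mult_commute by metis
  note pe = mem(1)[unfolded V_iff] mem(2,3)[unfolded U_iff]
  have vmem: "v \<cdot> A \<in> U" "v \<cdot> B \<in> U" "v \<cdot> C \<in> U"
    using V_times_V[OF v mem(1)] V_times_U[OF v mem(2)] V_times_U[OF v mem(3)] .
  note pe3 = vmem[unfolded U_iff]
  have u0: "u \<cdot> A = 0" "u \<cdot> B = 0" "u \<cdot> C = 0"
    using U_cube_zero[OF u] u_vv_zero[OF u v] u_uv_zero[OF u v] by (simp_all add: abc)
  have AB: "A \<cdot> B = 0" "B \<cdot> A = 0" using uu_vv_zero[OF u v] by (simp_all add: abc mult_commute)
  have BB: "B \<cdot> B = 0" using u_vv_zero[OF mem(2) v] by (simp add: abc)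
  have BC: "B \<cdot> C = 0" "C \<cdot> B = 0" using u_vv_zero[OF mem(3) v] by (simp_all add: abc mult_commute)
  have uvB: "u \<cdot> (v \<cdot> B) = 0"
    using u_uv_zero_linearized[OF u mem(2) v] by (simp add: abc BC mult_commute[of B v])
  have uvC: "u \<cdot> (v \<cdot> C) = - (C \<cdot> C)"
    using u_uv_zero_linearized[OF u mem(3) v] by (simp add: abc mult_commute[of C v] eq_neg_iff_add_eq_0)
  note a = quadratic_coefficients(1)[OF u v, unfolded abc]
    and w = quadratic_coefficients(2)[OF u v, unfolded abc]
    and p = quadratic_coefficients(3)[OF u v, unfolded abc]
  have na: "v \<cdot> A + v \<cdot> B + 2 *s (v \<cdot> C) = (u + v) \<cdot> (A + B + 2 *s C)"
    by (rule coord_eqI) (simp add: mul_expand u0)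
  have q: "(1 + h) *s (v \<cdot> A) + 2 *s (h *s (v \<cdot> B)) + 3 *s (v \<cdot> C)
      = e \<cdot> ((u + v) \<cdot> (A + B + 2 *s C)) + (u + v) \<cdot> (A + h *s B + 2 *s C)"
    unfolding na[symmetric]
    by (rule coord_eqI, simp add: mul_expand u0 pe3) (use two_h in algebra)
  obtain r where r: "r = (u + v) \<cdot> (v \<cdot> A + v \<cdot> B + 2 *s (v \<cdot> C))" by blast
  note eq = power_identities(3)[OF U_plus_V[OF u v] a w p q r[unfolded na]]
  have pe4: "e \<cdot> (u \<cdot> (v \<cdot> A)) = 0" "e \<cdot> (C \<cdot> C) = 0"
    using U_times_U[OF u vmem(1)] U_times_U[OF mem(3,3)] by (simp_all add: V_iff)
  have pe4': "e \<cdot> (v \<cdot> (v \<cdot> A)) = h *s (v \<cdot> (v \<cdot> A))" "e \<cdot> (v \<cdot> (v \<cdot> B)) = h *s (v \<cdot> (v \<cdot> B))"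
     "e \<cdot> (v \<cdot> (v \<cdot> C)) = h *s (v \<cdot> (v \<cdot> C))" "e \<cdot> (A \<cdot> A) = h *s (A \<cdot> A)" "e \<cdot> (A \<cdot> C) = h *s (A \<cdot> C)"
    using V_times_U[OF v vmem(1)] V_times_U[OF v vmem(2)] V_times_U[OF v vmem(3)]
      V_times_V[OF mem(1,1)] V_times_U[OF mem(1,3)]
    by (simp_all add: U_iff)
  note expand = r abc mul_expand u0 AB BB BC uvB uvC pe pe3 pe4 pe4' mult_commute[of C A]
  \<comment> \<open>Multiplication by \<open>e\<close> annihilates the \<open>V\<close>-component and so isolates the \<open>U\<close>-component.\<close>
  have part_U: "A \<cdot> A + 4 *s (A \<cdot> C) = 0"
  proof (rule coord_eqI)
    fix b
    show "coord b (A \<cdot> A + 4 *s (A \<cdot> C)) = coord b 0"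
      using arg_cong[OF eq, of "\<lambda>x. coord b (e \<cdot> x)"] two_h by (simp add: expand) algebra
  qed
  have part_V: "u \<cdot> (v \<cdot> A) + 2 *s (C \<cdot> C) = 0"
  proof (rule zero_of_scaled(1), rule coord_eqI)
    fix b
    show "coord b (2 *s (u \<cdot> (v \<cdot> A) + 2 *s (C \<cdot> C))) = coord b 0"
      using arg_cong[OF eq, of "coord b"] arg_cong[OF part_U, of "coord b"] two_h
      by (simp add: expand) algebra
  qed
  show "(u \<cdot> u) \<cdot> (u \<cdot> u) + 4 *s ((u \<cdot> u) \<cdot> (u \<cdot> v)) = 0"
    and "u \<cdot> (v \<cdot> (u \<cdot> u)) + 2 *s ((u \<cdot> v) \<cdot> (u \<cdot> v)) = 0"
    using part_U part_V by (simp_all add: abc)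
qed

text \<open>In each relation of \<open>degree_four\<close> one term is even and the other odd in \<open>u\<close>, so comparison with the
  relation for \<open>- u\<close> separates them.\<close>

lemma degree_four_products_zero:
  assumes u: "u \<in> U" and v: "v \<in> V"
  shows "(u \<cdot> u) \<cdot> (u \<cdot> u) = 0" and "(u \<cdot> u) \<cdot> (u \<cdot> v) = 0" and "(u \<cdot> v) \<cdot> (u \<cdot> v) = 0"
proof -
  note pos = degree_four[OF u v] and neg = degree_four[OF uminus_U[OF u] v]
  show sq: "(u \<cdot> u) \<cdot> (u \<cdot> u) = 0"
  proof (rule zero_of_scaled(1), rule coord_eqI)
    fix b
    show "coord b (2 *s ((u \<cdot> u) \<cdot> (u \<cdot> u))) = coord b 0"
      using arg_cong[OF pos(1), of "coord b"] arg_cong[OF neg(1), of "coord b"] by simp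
  qed
  show "(u \<cdot> u) \<cdot> (u \<cdot> v) = 0"
    by (rule zero_of_scaled(2)) (use pos(1) sq in simp)
  show "(u \<cdot> v) \<cdot> (u \<cdot> v) = 0"
  proof (rule zero_of_scaled(2), rule coord_eqI)
    fix b
    show "coord b (4 *s ((u \<cdot> v) \<cdot> (u \<cdot> v))) = coord b 0"
      using arg_cong[OF pos(2), of "coord b"] arg_cong[OF neg(2), of "coord b"] two_nonzero
      by auto
  qed
qed

text \<open>For \<open>x = \<alpha> e + u + v\<close> the square is \<open>\<alpha>\<^sup>2 e + \<alpha> u + a\<close> with \<open>a = u\<^sup>2 + v\<^sup>2 + 2 u v\<close>. Here \<open>u a = 0\<close> by
  the cubic relations, \<open>a\<^sup>2 = 0\<close> by the quartic ones, and \<open>u\<^sup>2 + 2 e a = a\<close> by the Peirce rules, which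
  is what the Bernstein identity amounts to. No division by \<open>\<alpha>\<close> occurs, so weight zero is included.\<close>

lemma square_of_square: "(x \<cdot> x) \<cdot> (x \<cdot> x) = (\<omega> x)\<^sup>2 *s (x \<cdot> x)"
proof -
  define \<alpha> where "\<alpha> = \<omega> x"
  define n where "n = x - \<alpha> *s e"
  define u where "u = 2 *s (e \<cdot> n)"
  define v where "v = n - u"
  have "\<omega> n = 0" by (simp add: n_def \<alpha>_def weight_idem)
  note half = half_or_zero[OF this]
  have u: "u \<in> U" using half by (simp add: U_def u_def mul_expand)
  have v: "v \<in> V" using half by (simp add: V_def u_def v_def mul_expand)
  obtain A B C where abc: "u \<cdot> u = A" "v \<cdot> v = B" "u \<cdot> v = C" by blast
  have vu: "v \<cdot> u = C" using abc mult_commute by metis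
  have mem: "A \<in> V" "B \<in> U" "C \<in> U" using U_times_U[OF u u] V_times_V[OF v v] U_times_V[OF u v]
    by (simp_all add: abc)
  note pe = mem(1)[unfolded V_iff] mem(2,3)[unfolded U_iff] u[unfolded U_iff] v[unfolded V_iff]
  note pe' = pe[unfolded mult_commute[of e]]
  have cubic: "u \<cdot> A = 0" "u \<cdot> B = 0" "u \<cdot> C = 0"
    using U_cube_zero[OF u] u_vv_zero[OF u v] u_uv_zero[OF u v] by (simp_all add: abc)
  note cubic' = cubic[unfolded mult_commute[of u]]
  have four: "A \<cdot> A = 0" "A \<cdot> C = 0" "C \<cdot> C = 0" "A \<cdot> B = 0" "B \<cdot> B = 0" "C \<cdot> B = 0"
    using degree_four_products_zero[OF u v] uu_vv_zero[OF u v]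
      u_vv_zero[OF mem(2) v] u_vv_zero[OF mem(3) v]
    by (simp_all add: abc)
  have four': "C \<cdot> A = 0" "B \<cdot> A = 0" "B \<cdot> C = 0"
    using four by (simp_all add: mult_commute)
  have x: "x = \<alpha> *s e + u + v" by (simp add: v_def n_def)
  have sq: "x \<cdot> x = \<alpha>\<^sup>2 *s e + \<alpha> *s u + (A + B + 2 *s C)"
    unfolding x
    by (rule coord_eqI, simp add: mul_expand idem pe pe' abc vu) (use two_h in algebra)
  show ?thesis
    unfolding sq \<alpha>_def[symmetric]
    by (rule coord_eqI, simp add: mul_expand idem pe pe' cubic cubic' four four' abc)
      (use two_h in algebra)
qed

end

section \<open>Characterization of the Bernstein algebras\<close>

theorem theorem4p1:
  fixes scale :: "'k::alg_closed_field \<Rightarrow> 'a::ab_group_add \<Rightarrow> 'a" (infixr \<open>*s\<close> 75)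
    and mul :: "'a \<Rightarrow> 'a \<Rightarrow> 'a" (infixl \<open>\<cdot>\<close> 70)
    and \<omega> :: "'a \<Rightarrow> 'k"
    and e :: 'a
    and s lam lam' :: 'k
  assumes "CHAR('k) \<noteq> 2"
    and "s\<^sup>2 = -23"
    and "lam = (-1 - s) / 4" and "lam' = (-1 + s) / 4"
    and "baric_algebra scale mul \<omega>"
    and "\<And>x. 2 *s (principal_power mul x 2 \<cdot> principal_power mul x 4) =
               (\<omega> x)\<^sup>2 *s principal_power mul x 4 + (\<omega> x)^4 *s principal_power mul x 2"
    and "e \<noteq> 0" and "e \<cdot> e = e"
    and "peirce_decomposition scale mul \<omega> e lam lam'"
  shows "bernstein_algebra scale mul \<omega> \<longleftrightarrow>
           peirce_space scale mul \<omega> e lam = {0} \<and> peirce_space scale mul \<omega> e lam' = {0}"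
proof -
  interpret baric_algebra scale mul \<omega> by fact
  have two: "(2::'k) \<noteq> 0"
  proof
    assume "(2::'k) = 0"
    then have "CHAR('k) dvd 2" by (metis of_nat_eq_0_iff_char_dvd of_nat_numeral)
    moreover have "\<not> CHAR('k) dvd 1" by (simp flip: of_nat_eq_0_iff_char_dvd)
    ultimately show False
      using assms(1) by (metis nat_dvd_1_iff_1 prime_nat_iff two_is_prime_nat)
  qed
  note inf = infinite_UNIV_alg_closed_field[where 'k = 'k]
  have quartic: "2 *s ((x \<cdot> x) \<cdot> (x \<cdot> (x \<cdot> (x \<cdot> x))))
      = (\<omega> x)\<^sup>2 *s (x \<cdot> (x \<cdot> (x \<cdot> x))) + (\<omega> x)^4 *s (x \<cdot> x)" for x
    using assms(6)[of x] by (simp add: eval_nat_numeral)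
  have we: "\<omega> e = 1"
  proof -
    have "\<omega> e * \<omega> e = \<omega> e" using weight_mult[of e e] by (simp add: assms(8))
    moreover have "\<omega> e \<noteq> 0"
      using quartic[of e] two assms(7) by (auto simp: assms(8))
    ultimately show ?thesis by simp
  qed
  let ?P = "peirce_space scale mul \<omega> e"
  have zero_P: "0 \<in> ?P \<alpha>" for \<alpha> by (simp add: peirce_space_def)
  let ?D = "range (\<lambda>c. scale c e) \<times> ?P 0 \<times> ?P (1/2) \<times> ?P lam \<times> ?P lam'"
  let ?sum = "\<lambda>(a, x, y, z, w). a + x + y + z + w"
  have inj: "inj_on ?sum ?D" and surj: "?sum ` ?D = UNIV"
    using assms(9) by (auto simp: peirce_decomposition_def bij_betw_def)
  have zero_e: "0 \<in> range (\<lambda>c. scale c e)" by (metis rangeI scale_zero_left)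
  show ?thesis
  proof
    assume "bernstein_algebra scale mul \<omega>"
    then interpret bernstein_algebra scale mul \<omega> .
    have disj: "\<alpha> = 0 \<or> \<alpha> = 1/2 \<or> y = 0" if "y \<in> ?P \<alpha>" for \<alpha> y
      using peirce_eigenvalue[OF inf two assms(8) we] that by (auto simp: peirce_space_def)
    \<comment> \<open>A vector in two different summands has two representations, with \<open>y\<close> in either slot.\<close>
    have "y = 0" if y: "y \<in> ?P lam" for y
    proof -
      have "y \<in> ?P 0 \<or> y \<in> ?P (1/2) \<Longrightarrow> y = 0"
        using inj_onD[OF inj, of "(0, y, 0, 0, 0)" "(0, 0, 0, y, 0)"]
          inj_onD[OF inj, of "(0, 0, y, 0, 0)" "(0, 0, 0, y, 0)"] y zero_P zero_e by auto
      then show ?thesis using disj[OF y] y by metis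
    qed
    moreover have "y = 0" if y: "y \<in> ?P lam'" for y
    proof -
      have "y \<in> ?P 0 \<or> y \<in> ?P (1/2) \<Longrightarrow> y = 0"
        using inj_onD[OF inj, of "(0, y, 0, 0, 0)" "(0, 0, 0, 0, y)"]
          inj_onD[OF inj, of "(0, 0, y, 0, 0)" "(0, 0, 0, 0, y)"] y zero_P zero_e by auto
      then show ?thesis using disj[OF y] y by metis
    qed
    ultimately show "?P lam = {0} \<and> ?P lam' = {0}" using zero_P by blast
  next
    assume triv: "?P lam = {0} \<and> ?P lam' = {0}"
    have half: "2 *s (e \<cdot> (e \<cdot> y)) = e \<cdot> y" if y: "\<omega> y = 0" for y
    proof -
      obtain c x z where xz: "x \<in> ?P 0" "z \<in> ?P (1/2)" and sum: "y = c *s e + x + z"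
        using surj triv by (force simp: image_iff set_eq_iff)
      have "c = 0" using y xz by (simp add: sum we peirce_space_def)
      then have "e \<cdot> y = (1/2) *s z"
        using xz by (simp add: sum peirce_space_def mul_add_right)
      then have "e \<cdot> (e \<cdot> y) = (1/2) *s (e \<cdot> y)"
        using xz by (simp add: peirce_space_def mul_scale_right)
      then show ?thesis using two by (simp only: scale_scale) simp
    qed
    \<comment> \<open>In characteristic \<open>3\<close> one of the two vanishing spaces is \<open>A\<^sub>0\<close> itself, because \<open>s\<^sup>2 = 1 - 24\<close>.\<close>
    have three: "(3::'k) \<noteq> 0 \<or> (\<forall>v. e \<cdot> v = 0 \<longrightarrow> v = 0)"
    proof (cases "(3::'k) = 0")
      case three: True
      have "(s - 1) * (s + 1) = s\<^sup>2 - 1" by (simp add: algebra_simps power2_eq_square)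
      also have "\<dots> = - 8 * 3" using assms(2) by simp
      finally have "s = 1 \<or> s = - 1" using three by (simp add: eq_neg_iff_add_eq_0)
      then have "lam' = 0 \<or> lam = 0" by (auto simp: assms(3,4))
      then have "?P 0 = {0}" using triv by auto
      moreover have "\<omega> v = 0" if "e \<cdot> v = 0" for v
        using weight_mult[of e v] that by (simp add: we)
      ultimately show ?thesis by (auto simp: peirce_space_def)
    qed simp
    interpret quartic_baric_algebra scale mul \<omega> e
      using inf two quartic assms(8) we half three by unfold_locales
    show "bernstein_algebra scale mul \<omega>"
      by unfold_locales (rule square_of_square)
  qed
qed

end
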